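(* Let $G$ be a graph that does not contain the cycle $C_4$ as a (not necessarily induced) subgraph. Then $\overset{\rightarrow}{\gamma}_{LD}(G)=\gamma_{LD}(G)$.
   Context: All graphs are finite and simple. For an undirected graph $G=(V,E)$, $S\subseteq V$ is a locating-dominating set if every $u\notin S$ has $N(u)\cap S\neq\emptyset$ and distinct $u,v\notin S$ satisfy $N(u)\cap S\neq N(v)\cap S$; $\gamma_{LD}(G)$ is the minimum size of such a set. For an orientation $D$ of $G$ (each edge given exactly one direction), $S$ is locating-dominating in $D$ if the same holds with $N(\cdot)$ replaced by the in-neighbourhood $N^-_D(\cdot)$; $\gamma_{LD}(D)$ is the minimum size. $\overset{\rightarrow}{\gamma}_{LD}(G)=\min_D\gamma_{LD}(D)$ over all orientations $D$ of $G$. *)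

theory Defs
  imports "Graph_Theory.Graph_Theory"
begin

text \<open>
  A finite simple undirected graph is a \<^locale>\<open>pair_graph\<close>: a finite loopless digraph whose arc
  relation is symmetric, each undirected edge being represented by its two opposite arcs.
\<close>

definition nbhd :: "'a pair_pre_digraph \<Rightarrow> 'a \<Rightarrow> 'a set" where
  "nbhd G u = {v. (u, v) \<in> parcs G}"

definition in_nbhd :: "'a pair_pre_digraph \<Rightarrow> 'a \<Rightarrow> 'a set" where
  "in_nbhd D u = {v. (v, u) \<in> parcs D}"

text \<open>The condition common to graphs and digraphs, for a neighbourhood function \<open>N\<close>.\<close>

definition locating_dominating_wrt :: "'a set \<Rightarrow> ('a \<Rightarrow> 'a set) \<Rightarrow> 'a set \<Rightarrow> bool" where
  "locating_dominating_wrt V N S \<longleftrightarrow>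
     S \<subseteq> V \<and>
     (\<forall>u \<in> V - S. N u \<inter> S \<noteq> {}) \<and>
     (\<forall>u \<in> V - S. \<forall>v \<in> V - S. u \<noteq> v \<longrightarrow> N u \<inter> S \<noteq> N v \<inter> S)"

definition locating_dominating :: "'a pair_pre_digraph \<Rightarrow> 'a set \<Rightarrow> bool" where
  "locating_dominating G S \<longleftrightarrow> locating_dominating_wrt (pverts G) (nbhd G) S"

definition dir_locating_dominating :: "'a pair_pre_digraph \<Rightarrow> 'a set \<Rightarrow> bool" where
  "dir_locating_dominating D S \<longleftrightarrow> locating_dominating_wrt (pverts D) (in_nbhd D) S"

definition gamma_LD :: "'a pair_pre_digraph \<Rightarrow> nat" where
  "gamma_LD G = Min (card ` {S. locating_dominating G S})"

definition dir_gamma_LD :: "'a pair_pre_digraph \<Rightarrow> nat" where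
  "dir_gamma_LD D = Min (card ` {S. dir_locating_dominating D S})"

text \<open>In the last conjunct, \<open>\<noteq>\<close> between propositions is exclusive or.\<close>

definition orientation :: "'a pair_pre_digraph \<Rightarrow> 'a pair_pre_digraph \<Rightarrow> bool" where
  "orientation D G \<longleftrightarrow>
     pverts D = pverts G \<and>
     parcs D \<subseteq> parcs G \<and>
     (\<forall>u v. (u, v) \<in> parcs G \<longrightarrow> ((u, v) \<in> parcs D) \<noteq> ((v, u) \<in> parcs D))"

definition oriented_gamma_LD :: "'a pair_pre_digraph \<Rightarrow> nat" where
  "oriented_gamma_LD G = Min (dir_gamma_LD ` {D. orientation D G})"

text \<open>The cycle on \<open>0, \<dots>, n - 1\<close>, intended for \<open>n \<ge> 3\<close>.\<close>

definition cycle_graph :: "nat \<Rightarrow> nat pair_pre_digraph" where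
  "cycle_graph n = \<lparr> pverts = {..<n},
     parcs = {(i, j). i < n \<and> j < n \<and> (j = Suc i mod n \<or> i = Suc j mod n)} \<rparr>"

text \<open>Containment as a not necessarily induced subgraph, up to isomorphism.\<close>

definition contains_copy :: "'a pair_pre_digraph \<Rightarrow> 'b pair_pre_digraph \<Rightarrow> bool" where
  "contains_copy G F \<longleftrightarrow>
     (\<exists>H :: 'a pair_pre_digraph.
        subgraph (with_proj H) (with_proj G) \<and> digraph_iso (with_proj F) (with_proj H))"

text \<open>All minima above are taken over finite nonempty sets.\<close>

lemma locating_dominating_wrt_verts: "locating_dominating_wrt V N V"
  by (simp add: locating_dominating_wrt_def)

lemma finite_locating_dominating_wrt:
  "finite V \<Longrightarrow> finite {S. locating_dominating_wrt V N S}"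
  by (rule finite_subset[of _ "Pow V"]) (auto simp: locating_dominating_wrt_def)

lemma gamma_LD_attained:
  assumes "finite (pverts G)"
  shows "\<exists>S. locating_dominating G S \<and> card S = gamma_LD G"
proof -
  have "gamma_LD G \<in> card ` {S. locating_dominating G S}"
    unfolding gamma_LD_def locating_dominating_def
    using assms finite_locating_dominating_wrt locating_dominating_wrt_verts
    by (intro Min_in) blast+
  then show ?thesis by auto
qed

lemma dir_gamma_LD_attained:
  assumes "finite (pverts D)"
  shows "\<exists>S. dir_locating_dominating D S \<and> card S = dir_gamma_LD D"
proof -
  have "dir_gamma_LD D \<in> card ` {S. dir_locating_dominating D S}"
    unfolding dir_gamma_LD_def dir_locating_dominating_def
    using assms finite_locating_dominating_wrt locating_dominating_wrt_verts
    by (intro Min_in) blast+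
  then show ?thesis by auto
qed

lemma orientation_exists:
  assumes "pair_graph G"
  shows "\<exists>D. orientation D G"
proof -
  interpret pair_graph G by (rule assms)
  obtain f :: "'a \<Rightarrow> nat" where f: "inj_on f (pverts G)"
    using pair_finite_verts finite_imp_inj_to_nat_seg by metis
  let ?D = "\<lparr> pverts = pverts G, parcs = {(u, v) \<in> parcs G. f u < f v} \<rparr>"
  have sym: "(v, u) \<in> parcs G" if "(u, v) \<in> parcs G" for u v
    using pair_sym_arcs that by (simp add: symmetric_def sym_def)
  have "f u \<noteq> f v" if "(u, v) \<in> parcs G" for u v
    using that f pair_no_loops[OF that] by (auto dest: inj_onD in_arcsD1 in_arcsD2)
  then have "orientation ?D G"
    unfolding orientation_def using sym by (auto simp: not_less_iff_gr_or_eq)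
  then show ?thesis ..
qed

lemma finite_orientations:
  assumes "pair_graph G"
  shows "finite {D. orientation D G}"
proof -
  interpret pair_graph G by (rule assms)
  have "{D. orientation D G} \<subseteq> (\<lambda>A. \<lparr> pverts = pverts G, parcs = A \<rparr>) ` Pow (parcs G)"
  proof
    fix D assume "D \<in> {D. orientation D G}"
    then show "D \<in> (\<lambda>A. \<lparr> pverts = pverts G, parcs = A \<rparr>) ` Pow (parcs G)"
      by (cases D) (auto simp: orientation_def)
  qed
  then show ?thesis
    using pair_finite_arcs by (meson finite_Pow_iff finite_imageI finite_subset)
qed

lemma oriented_gamma_LD_attained:
  assumes "pair_graph G"
  shows "\<exists>D. orientation D G \<and> dir_gamma_LD D = oriented_gamma_LD G"
proof -
  have "oriented_gamma_LD G \<in> dir_gamma_LD ` {D. orientation D G}"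
    unfolding oriented_gamma_LD_def
    using assms finite_orientations orientation_exists by (intro Min_in) blast+
  then show ?thesis by auto
qed

end

theory Submission
  imports Defs
begin

text \<open>
  Orienting all edges between \<open>S\<close> and its complement away from \<open>S\<close> leaves \<open>N(u) \<inter> S\<close> unchanged for
  \<open>u \<notin> S\<close>, so \<open>\<le>\<close> holds in every graph. Conversely, a set \<open>S\<close> that is locating-dominating in an
  orientation dominates \<open>G\<close>. If \<open>u, v \<notin> S\<close> had \<open>N(u) \<inter> S = N(v) \<inter> S\<close>, this set would be a singleton,
  since two elements would form a \<open>C\<^sub>4\<close> with \<open>u\<close> and \<open>v\<close>. Then the nonempty in-neighbourhoods of
  \<open>u\<close> and \<open>v\<close> in \<open>S\<close> would both equal that singleton, contradicting location in the orientation.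
\<close>

lemma (in pair_graph) arc_commute: "(u, v) \<in> parcs G \<longleftrightarrow> (v, u) \<in> parcs G"
  using pair_sym_arcs by (auto simp: symmetric_def sym_def)

lemma gamma_LD_le:
  assumes "finite (pverts G)" "locating_dominating G S"
  shows "gamma_LD G \<le> card S"
  unfolding gamma_LD_def locating_dominating_def
  using assms(2)[unfolded locating_dominating_def] finite_locating_dominating_wrt[OF assms(1)]
  by (intro Min_le) auto

lemma dir_gamma_LD_le:
  assumes "finite (pverts D)" "dir_locating_dominating D S"
  shows "dir_gamma_LD D \<le> card S"
  unfolding dir_gamma_LD_def dir_locating_dominating_def
  using assms(2)[unfolded dir_locating_dominating_def] finite_locating_dominating_wrt[OF assms(1)]
  by (intro Min_le) auto

lemma oriented_gamma_LD_le:
  assumes "pair_graph G" "orientation D G"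
  shows "oriented_gamma_LD G \<le> dir_gamma_LD D"
  unfolding oriented_gamma_LD_def
  using assms finite_orientations by (intro Min_le) auto

text \<open>Reduces containment to an injective arc-preserving vertex map. The witness subgraph is
  the image of \<open>F\<close> under \<open>f\<close>; since the arcs of \<open>F\<close> join
  vertices of \<open>F\<close>, injectivity of \<open>f\<close> carries over to
  \<open>map_prod f f\<close> on arcs.\<close>

lemma contains_copyI:
  assumes "pair_wf_digraph F" "pair_wf_digraph G" "inj_on f (pverts F)"
    and "f ` pverts F \<subseteq> pverts G" "map_prod f f ` parcs F \<subseteq> parcs G"
  shows "contains_copy G F"
proof -
  interpret F: pair_wf_digraph F by fact
  let ?H = "\<lparr> pverts = f ` pverts F, parcs = map_prod f f ` parcs F \<rparr>"
  \<comment> \<open>Arcs of the image are again pairs, so its tail and head maps are the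
    projections.\<close>
  let ?h = "\<lparr> iso_verts = f, iso_arcs = map_prod f f, iso_head = snd, iso_tail = fst \<rparr>"
  have arcs: "parcs F \<subseteq> pverts F \<times> pverts F"
    using F.in_arcsD1 F.in_arcsD2 by auto
  have "pair_wf_digraph ?H"
    using arcs by unfold_locales auto
  then have "subgraph (with_proj ?H) (with_proj G)"
    using assms by (intro subgraphI) (auto simp: wf_digraph_wp_iff)
  moreover have "inj_on (map_prod f f) (parcs F)"
    using map_prod_inj_on[OF assms(3) assms(3)] arcs by (rule inj_on_subset)
  then have "pre_digraph.digraph_isomorphism (with_proj F) ?h"
    using assms by (simp add: pre_digraph.digraph_isomorphism_def wf_digraph_wp_iff)
  moreover have "with_proj ?H = app_iso ?h (with_proj F)"
    by (simp add: with_proj_def app_iso_def)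
  ultimately show ?thesis
    unfolding contains_copy_def digraph_iso_def by blast
qed

lemma cycle_graph_4_arcs:
  "parcs (cycle_graph 4) = {(0, 1), (1, 2), (2, 3), (3, 0), (1, 0), (2, 1), (3, 2), (0, 3)}"
proof -
  \<comment> \<open>Written as images of a finite set, the arcs can be enumerated by the
    simplifier.\<close>
  have "parcs (cycle_graph 4) =
      (\<lambda>i. (i, Suc i mod 4)) ` {..<4} \<union> (\<lambda>i. (Suc i mod 4, i)) ` {..<4}"
    by (auto simp: cycle_graph_def)
  moreover have "{..<4} = {0, 1, 2, 3 :: nat}"
    by auto
  ultimately show ?thesis
    by (simp add: insert_commute flip: numeral_2_eq_2)
qed

lemma contains_copy_cycle_graph_4I:
  assumes "pair_graph G" "distinct [a, b, c, d]"
    and "(a, b) \<in> parcs G" "(b, c) \<in> parcs G" "(c, d) \<in> parcs G" "(d, a) \<in> parcs G"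
  shows "contains_copy G (cycle_graph 4)"
proof -
  interpret pair_graph G by fact
  \<comment> \<open>List positions serve as the cycle's vertices, so distinctness of the list gives
    injectivity.\<close>
  let ?f = "\<lambda>i. [a, b, c, d] ! i"
  show ?thesis
  proof (rule contains_copyI[of _ _ ?f])
    show "pair_wf_digraph (cycle_graph 4)"
      by unfold_locales (auto simp: cycle_graph_def)
    show "pair_wf_digraph G" ..
    show "inj_on ?f (pverts (cycle_graph 4))"
      using inj_on_nth[OF assms(2), of "{..<4}"] by (simp add: cycle_graph_def)
    have "?f ` {..<4} \<subseteq> set [a, b, c, d]"
      by (intro image_subsetI nth_mem) simp
    also have "\<dots> \<subseteq> pverts G"
      using assms(3-6)[THEN in_arcsD1] by simp
    finally show "?f ` pverts (cycle_graph 4) \<subseteq> pverts G"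
      by (simp add: cycle_graph_def)
    show "map_prod ?f ?f ` parcs (cycle_graph 4) \<subseteq> parcs G"
      using assms(3-6) assms(3-6)[THEN arc_commute[THEN iffD1]] by (simp add: cycle_graph_4_arcs)
  qed
qed

lemma oriented_gamma_LD_le_gamma_LD:
  assumes "pair_graph G"
  shows "oriented_gamma_LD G \<le> gamma_LD G"
proof -
  interpret pair_graph G by fact
  obtain S where S: "locating_dominating G S" "card S = gamma_LD G"
    using gamma_LD_attained pair_finite_verts by blast
  obtain D\<^sub>0 where D0: "orientation D\<^sub>0 G"
    using orientation_exists assms by blast
  \<comment> \<open>\<open>D\<^sub>0\<close> is an arbitrary orientation and decides only the edges
    with both ends on the same side of \<open>S\<close>. These do not affect in-neighbours in
    \<open>S\<close> of vertices outside \<open>S\<close>.\<close>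
  let ?D = "\<lparr> pverts = pverts G,
    parcs = {(u, v) \<in> parcs G. if u \<in> S \<longleftrightarrow> v \<in> S then (u, v) \<in> parcs D\<^sub>0 else u \<in> S} \<rparr>"
  have D: "orientation ?D G"
    unfolding orientation_def
  proof (intro conjI allI impI)
    fix u v
    assume uv: "(u, v) \<in> parcs G"
    then have "((u, v) \<in> parcs D\<^sub>0) \<noteq> ((v, u) \<in> parcs D\<^sub>0)"
      using D0 unfolding orientation_def by blast
    then show "((u, v) \<in> parcs ?D) \<noteq> ((v, u) \<in> parcs ?D)"
      using uv arc_commute[of u v] by auto
  qed auto
  have "in_nbhd ?D u \<inter> S = nbhd G u \<inter> S" if "u \<notin> S" for u
    using that by (auto simp: in_nbhd_def nbhd_def arc_commute)
  then have "dir_locating_dominating ?D S"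
    using S(1)
    by (simp add: dir_locating_dominating_def locating_dominating_def locating_dominating_wrt_def)
  then have "dir_gamma_LD ?D \<le> card S"
    by (intro dir_gamma_LD_le) simp_all
  then show ?thesis
    using oriented_gamma_LD_le[OF assms D] S(2) by simp
qed

lemma locating_dominating_if_dir_locating_dominating:
  assumes "pair_graph G" "\<not> contains_copy G (cycle_graph 4)"
    and "orientation D G" "dir_locating_dominating D S"
  shows "locating_dominating G S"
proof -
  interpret pair_graph G by fact
  have verts: "pverts D = pverts G" and arcs: "parcs D \<subseteq> parcs G"
    using assms(3) unfolding orientation_def by blast+
  have in_nbhd_subset: "in_nbhd D u \<subseteq> nbhd G u" for u
    using arcs arc_commute unfolding in_nbhd_def nbhd_def by blast
  have S: "S \<subseteq> pverts G"
    and dom: "\<And>u. u \<in> pverts G - S \<Longrightarrow> in_nbhd D u \<inter> S \<noteq> {}"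
    and loc: "\<And>u v. \<lbrakk>u \<in> pverts G - S; v \<in> pverts G - S; u \<noteq> v\<rbrakk>
      \<Longrightarrow> in_nbhd D u \<inter> S \<noteq> in_nbhd D v \<inter> S"
    using assms(4) by (auto simp: dir_locating_dominating_def locating_dominating_wrt_def verts)
  have "nbhd G u \<inter> S \<noteq> nbhd G v \<inter> S"
    if u: "u \<in> pverts G - S" and v: "v \<in> pverts G - S" and "u \<noteq> v" for u v
  proof
    assume eq: "nbhd G u \<inter> S = nbhd G v \<inter> S"
    have unique: "s = t" if "s \<in> nbhd G u \<inter> S" "t \<in> nbhd G u \<inter> S" for s t
    proof (rule ccontr)
      assume "s \<noteq> t"
      \<comment> \<open>The vertices alternate between the complement of \<open>S\<close> and
        \<open>S\<close>, so adjacent entries differ.\<close>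
      then have "distinct [u, s, v, t]"
        using u v \<open>u \<noteq> v\<close> that by auto
      moreover have "(u, s) \<in> parcs G" "(u, t) \<in> parcs G" "(v, s) \<in> parcs G" "(v, t) \<in> parcs G"
        using that that[unfolded eq] by (auto simp: nbhd_def)
      ultimately have "contains_copy G (cycle_graph 4)"
        using contains_copy_cycle_graph_4I[OF assms(1)] arc_commute by blast
      then show False using assms(2) by contradiction
    qed
    \<comment> \<open>Both sides are nonempty subsets of the common set
      \<open>nbhd G u \<inter> S\<close>, which has at most one element by
      \<open>unique\<close>.\<close>
    have "in_nbhd D u \<inter> S = in_nbhd D v \<inter> S"
      using dom[OF u] dom[OF v] in_nbhd_subset[of u] in_nbhd_subset[of v] eq unique by blast
    then show False using loc[OF u v \<open>u \<noteq> v\<close>] by contradiction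
  qed
  moreover have "nbhd G u \<inter> S \<noteq> {}" if "u \<in> pverts G - S" for u
    using dom[OF that] in_nbhd_subset by blast
  ultimately show ?thesis
    using S unfolding locating_dominating_def locating_dominating_wrt_def by blast
qed

theorem theorem10:
  fixes G :: "'a pair_pre_digraph"
  assumes "pair_graph G"
    and "\<not> contains_copy G (cycle_graph 4)"
  shows "oriented_gamma_LD G = gamma_LD G"
proof (rule antisym)
  show "oriented_gamma_LD G \<le> gamma_LD G"
    using assms(1) by (rule oriented_gamma_LD_le_gamma_LD)
  interpret pair_graph G by fact
  \<comment> \<open>A minimum set of an optimal orientation is locating-dominating in
    \<open>G\<close> itself, so its size bounds \<open>gamma_LD G\<close> from above.\<close>
  obtain D where D: "orientation D G" "dir_gamma_LD D = oriented_gamma_LD G"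
    using oriented_gamma_LD_attained assms(1) by blast
  then have "finite (pverts D)"
    unfolding orientation_def by simp
  then obtain S where "dir_locating_dominating D S" "card S = dir_gamma_LD D"
    using dir_gamma_LD_attained by blast
  then show "gamma_LD G \<le> oriented_gamma_LD G"
    using gamma_LD_le[OF pair_finite_verts] D assms
      locating_dominating_if_dir_locating_dominating by metis
qed

end
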